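(* Let $g \in L^2(\mathbb{R}^d)$ be an arbitrary window function. If $\mathcal{L} \subseteq \mathbb{R}^{2d}$ satisfies $\mathcal{L} \subseteq S(\mathbb{R}^d \times \Lambda)=\{S(x,\lambda):x\in\mathbb{R}^d,\lambda\in\Lambda\}$ for some symplectic matrix $S \in \mathrm{Sp}_{2d}(\mathbb{R})$ and some lattice $\Lambda \subseteq \mathbb{R}^d$, then the set $$\mathcal{N}(g,\mathcal{L}) = \{ f \in L^2(\mathbb{R}^d) : \exists h \in L^2(\mathbb{R}^d) \text{ with } h \nsim f \text{ and } |V_gf(z)| = |V_gh(z)| \ \forall z\in\mathcal{L} \}$$ contains an infinite-dimensional cone.
   Context: $V_gf(x,\omega)=\int_{\mathbb{R}^d} f(t)\overline{g(t-x)}e^{-2\pi i \omega\cdot t}\,dt$ is the short-time Fourier transform. For functions $f,h$, $f\sim h$ means there is $\nu\in\mathbb{C}$, $|\nu|=1$, with $f=\nu h$; $f\nsim h$ means this fails. A lattice in $\mathbb{R}^d$ is $A\mathbb{Z}^d$ with $A\in\mathrm{GL}_d(\mathbb{R})$. $\mathrm{Sp}_{2d}(\mathbb{R})=\{S\in\mathrm{GL}_{2d}(\mathbb{R}):S^T\mathcal{J}S=\mathcal{J}\}$ with $\mathcal{J}=\begin{pmatrix}0&-I_d\\ I_d&0\end{pmatrix}$. A cone in a vector space $V$ is a set $C\subseteq V$ with $\kappa C\subseteq C$ for all $\kappa>0$; it is infinite-dimensional if it is not contained in any finite-dimensional subspace of $V$. *)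

theory Defs
  imports "HOL-Analysis.Analysis"
begin

text \<open>R^d is real^'d; R^{2d} is real^('d::finite + 'd), where coordinates Inl i are the
  space part x and coordinates Inr i the frequency part omega.\<close>

definition L2 :: "((real^'d::finite) \<Rightarrow> complex) set" where
  "L2 = {f. f \<in> borel_measurable lebesgue \<and> integrable lebesgue (\<lambda>t. (cmod (f t))^2)}"

definition pos_part :: "real^('d::finite + 'd) \<Rightarrow> real^'d" where
  "pos_part z = (\<chi> i. z $ Inl i)"

definition freq_part :: "real^('d::finite + 'd) \<Rightarrow> real^'d" where
  "freq_part z = (\<chi> i. z $ Inr i)"

definition STFT :: "(real^'d \<Rightarrow> complex) \<Rightarrow> (real^'d \<Rightarrow> complex) \<Rightarrow> real^('d::finite + 'd) \<Rightarrow> complex" where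
  "STFT g f z = (LINT t|lebesgue. f t * cnj (g (t - pos_part z))
       * exp (- 2 * of_real pi * \<i> * of_real (freq_part z \<bullet> t)))"

definition l2_equiv :: "(real^'d \<Rightarrow> complex) \<Rightarrow> (real^'d \<Rightarrow> complex) \<Rightarrow> bool" where
  "l2_equiv f h \<longleftrightarrow> (\<exists>\<nu>::complex. cmod \<nu> = 1 \<and> (AE t in lebesgue. f t = \<nu> * h t))"

definition is_lattice :: "(real^'d) set \<Rightarrow> bool" where
  "is_lattice \<Lambda> \<longleftrightarrow> (\<exists>A::real^'d^'d. invertible A \<and>
      \<Lambda> = {A *v (\<chi> i. real_of_int (k $ i)) | k :: int^'d. True})"

definition J_mat :: "real^('d::finite + 'd)^('d::finite + 'd)" where
  "J_mat = (\<chi> i j. (case (i, j) of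
       (Inl a, Inr b) \<Rightarrow> (if a = b then -1 else 0)
     | (Inr a, Inl b) \<Rightarrow> (if a = b then 1 else 0)
     | _ \<Rightarrow> 0))"

definition symplectic :: "real^('d::finite + 'd)^('d::finite + 'd) \<Rightarrow> bool" where
  "symplectic S \<longleftrightarrow> invertible S \<and> transpose S ** J_mat ** S = J_mat"

definition N_set :: "(real^'d \<Rightarrow> complex) \<Rightarrow> (real^('d::finite + 'd)) set \<Rightarrow> ((real^'d::finite) \<Rightarrow> complex) set" where
  "N_set g L = {f \<in> L2. \<exists>h \<in> L2. \<not> l2_equiv h f \<and>
       (\<forall>z \<in> L. cmod (STFT g f z) = cmod (STFT g h z))}"

definition is_cone :: "(real^'d \<Rightarrow> complex) set \<Rightarrow> bool" where
  "is_cone C \<longleftrightarrow> (\<forall>\<kappa>::real. \<kappa> > 0 \<longrightarrow> (\<forall>f \<in> C. (\<lambda>t. of_real \<kappa> * f t) \<in> C))"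

text \<open>Finite-dimensional subspaces of L^2 are the (complex) spans of finite subsets of L^2,
  with elements identified up to a.e. equality.\<close>
definition l2_span :: "(real^'d \<Rightarrow> complex) set \<Rightarrow> ((real^'d::finite) \<Rightarrow> complex) set" where
  "l2_span F = {f. \<exists>c. AE t in lebesgue. f t = (\<Sum>h\<in>F. c h * h t)}"

definition infinite_dim :: "(real^'d \<Rightarrow> complex) set \<Rightarrow> bool" where
  "infinite_dim C \<longleftrightarrow> (\<forall>F. finite F \<and> F \<subseteq> L2 \<longrightarrow> \<not> C \<subseteq> l2_span F)"

end

theory Submission
  imports Defs "HOL-Computational_Algebra.Fundamental_Theorem_Algebra"
begin

text \<open>
  Write \<open>\<rho> w\<close> for the time-frequency shift by \<open>w\<close> with symmetric phase. The transform of the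
  reflected window \<open>\<phi> t = g (- t)\<close> equals, up to the phase \<open>exp (- \<pi> i x \<omega>)\<close>, a Wigner
  distribution, hence is real. Shifting \<open>\<phi>\<close> by \<open>w\<close> preserves this at every \<open>z\<close> whose symplectic
  pairing with \<open>w\<close> is an integer. For \<open>w = k S (\<mu>, 0)\<close> with \<open>\<mu>\<close> in the dual lattice of \<open>\<Lambda>\<close> this
  holds on all of \<open>L\<close>, so \<open>\<phi> + i \<rho> w \<phi>\<close> and \<open>\<phi> - i \<rho> w \<phi>\<close> have the same spectrogram on \<open>L\<close>, being
  conjugate there up to a common phase. The functions \<open>\<rho> (k w) \<phi>\<close> are linearly independent because
  \<open>\<rho> w\<close> has no eigenvectors in \<open>L2\<close>: factor an annihilating polynomial. No metaplectic
  operator is involved. If \<open>g\<close> vanishes almost everywhere, any nonzero \<open>\<phi>\<close> does.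
\<close>

section \<open>Lebesgue measure under translations and point reflections\<close>

lemma lebesgue_isometric_affine_measurable:
  fixes a :: "'a::euclidean_space"
  assumes "\<bar>s\<bar> = (1::real)"
  shows "(\<lambda>x. a + s *\<^sub>R x) \<in> lebesgue \<rightarrow>\<^sub>M lebesgue"
proof -
  have "(\<lambda>x. a + (\<Sum>j\<in>Basis. (s * (x \<bullet> j)) *\<^sub>R j)) = (\<lambda>x. a + s *\<^sub>R x)"
    by (simp add: euclidean_representation flip: scaleR_scaleR scaleR_sum_right)
  moreover have "s \<noteq> 0" using assms by auto
  ultimately show ?thesis
    using lebesgue_affine_measurable[of "\<lambda>_. s" a] by simp
qed

lemma distr_lebesgue_isometric_affine:
  fixes a :: "'a::euclidean_space"
  assumes "\<bar>s\<bar> = (1::real)"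
  shows "distr lebesgue lebesgue (\<lambda>x. a + s *\<^sub>R x) = lebesgue"
proof -
  have "(\<lambda>x. a + (\<Sum>j\<in>Basis. (s * (x \<bullet> j)) *\<^sub>R j)) = (\<lambda>x. a + s *\<^sub>R x)"
    by (simp add: euclidean_representation flip: scaleR_scaleR scaleR_sum_right)
  moreover have "s \<noteq> 0" using assms by auto
  ultimately show ?thesis
    using lebesgue_affine_euclidean[of "\<lambda>_. s" a] assms by (simp add: density_1)
qed

text \<open>Change of variables, using that the image of Lebesgue measure is Lebesgue measure
  itself. Two cases matter below: \<open>s = 1\<close> gives translations, \<open>s = -1\<close> the
  reflection about \<open>a / 2\<close>.\<close>

lemma
  fixes a :: "'a::euclidean_space" and f :: "'a \<Rightarrow> 'b::{banach, second_countable_topology}"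
  assumes s: "\<bar>s\<bar> = (1::real)"
  shows borel_measurable_lebesgue_isometric_affine:
      "f \<in> borel_measurable lebesgue \<Longrightarrow> (\<lambda>x. f (a + s *\<^sub>R x)) \<in> borel_measurable lebesgue"
    and integrable_lebesgue_isometric_affine:
      "integrable lebesgue f \<Longrightarrow> integrable lebesgue (\<lambda>x. f (a + s *\<^sub>R x))"
    and integral_lebesgue_isometric_affine:
      "f \<in> borel_measurable lebesgue \<Longrightarrow>
        (LINT x|lebesgue. f (a + s *\<^sub>R x)) = (LINT x|lebesgue. f x)"
    and AE_lebesgue_isometric_affine:
      "AE x in lebesgue. P x \<Longrightarrow> AE x in lebesgue. P (a + s *\<^sub>R x)"
proof -
  note T = lebesgue_isometric_affine_measurable[OF s, of a]
  note D = distr_lebesgue_isometric_affine[OF s, of a]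
  show "f \<in> borel_measurable lebesgue \<Longrightarrow> (\<lambda>x. f (a + s *\<^sub>R x)) \<in> borel_measurable lebesgue"
    using measurable_compose[OF T] .
  show "integrable lebesgue f \<Longrightarrow> integrable lebesgue (\<lambda>x. f (a + s *\<^sub>R x))"
    using integrable_distr[OF T, of f] D by simp
  show "f \<in> borel_measurable lebesgue \<Longrightarrow>
        (LINT x|lebesgue. f (a + s *\<^sub>R x)) = (LINT x|lebesgue. f x)"
    using integral_distr[OF T, of f] D by simp
  show "AE x in lebesgue. P x \<Longrightarrow> AE x in lebesgue. P (a + s *\<^sub>R x)"
    using AE_distrD[OF T, of P] unfolding D .
qed

lemma
  fixes a :: "'a::euclidean_space" and f :: "'a \<Rightarrow> 'b::{banach, second_countable_topology}"
  shows borel_measurable_lebesgue_translate: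
      "f \<in> borel_measurable lebesgue \<Longrightarrow> (\<lambda>x. f (x - a)) \<in> borel_measurable lebesgue"
    and integrable_lebesgue_translate:
      "integrable lebesgue f \<Longrightarrow> integrable lebesgue (\<lambda>x. f (x - a))"
    and integral_lebesgue_translate:
      "f \<in> borel_measurable lebesgue \<Longrightarrow>
        (LINT x|lebesgue. f (x - a)) = (LINT x|lebesgue. f x)"
    and AE_lebesgue_translate:
      "AE x in lebesgue. P x \<Longrightarrow> AE x in lebesgue. P (x - a)"
  using borel_measurable_lebesgue_isometric_affine[of 1 f "-a"]
    integrable_lebesgue_isometric_affine[of 1 f "-a"]
    integral_lebesgue_isometric_affine[of 1 f "-a"]
    AE_lebesgue_isometric_affine[of 1 P "-a"]
  by simp_all

lemma
  fixes a :: "'a::euclidean_space" and f :: "'a \<Rightarrow> 'b::{banach, second_countable_topology}"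
  shows borel_measurable_lebesgue_reflect:
      "f \<in> borel_measurable lebesgue \<Longrightarrow> (\<lambda>x. f (a - x)) \<in> borel_measurable lebesgue"
    and integrable_lebesgue_reflect:
      "integrable lebesgue f \<Longrightarrow> integrable lebesgue (\<lambda>x. f (a - x))"
    and integral_lebesgue_reflect:
      "f \<in> borel_measurable lebesgue \<Longrightarrow>
        (LINT x|lebesgue. f (a - x)) = (LINT x|lebesgue. f x)"
    and AE_lebesgue_reflect:
      "AE x in lebesgue. P x \<Longrightarrow> AE x in lebesgue. P (a - x)"
  using borel_measurable_lebesgue_isometric_affine[of "-1" f a]
    integrable_lebesgue_isometric_affine[of "-1" f a]
    integral_lebesgue_isometric_affine[of "-1" f a]
    AE_lebesgue_isometric_affine[of "-1" P a]
  by simp_all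

text \<open>Integrating the relation forces \<open>c = 1\<close> unless the integral is already
  zero. Then \<open>u\<close> is periodic along \<open>a\<close>, so its mass on a ball equals its
  mass on translates of that ball, and these escape to infinity.\<close>

lemma AE_zero_if_translation_quasiperiodic:
  fixes u :: "'a::euclidean_space \<Rightarrow> real"
  assumes u: "integrable lebesgue u" and nonneg: "\<And>t. 0 \<le> u t" and "a \<noteq> 0"
    and per: "AE t in lebesgue. u (t - a) = c * u t"
  shows "AE t in lebesgue. u t = 0"
proof (cases "(LINT t|lebesgue. u t) = 0")
  case True
  then show ?thesis
    using integral_nonneg_eq_0_iff_AE[OF u] nonneg by simp
next
  case False
  have [measurable]: "u \<in> borel_measurable lebesgue" "\<And>b. (\<lambda>t. u (t - b)) \<in> borel_measurable lebesgue"
    using u by (auto intro: borel_measurable_lebesgue_translate)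
  have "(LINT t|lebesgue. u t) = (LINT t|lebesgue. u (t - a))"
    by (rule integral_lebesgue_translate[symmetric]) simp
  also have "\<dots> = (LINT t|lebesgue. c * u t)"
    by (rule integral_cong_AE) (use per in auto)
  finally have "c = 1" using False by simp
  have pern: "AE t in lebesgue. u (t - real n *\<^sub>R a) = u t" for n
  proof (induction n)
    case (Suc n)
    have "AE t in lebesgue. u ((t - real n *\<^sub>R a) - a) = u (t - real n *\<^sub>R a)"
      using AE_lebesgue_translate[OF per] \<open>c = 1\<close> by simp
    with Suc show ?case
      by eventually_elim (simp add: algebra_simps)
  qed simp
  have zero: "(LINT t|lebesgue. indicator (ball 0 R) t * u t) = 0" for R
  proof -
    let ?I = "LINT t|lebesgue. indicator (ball 0 R) t * u t"
    \<comment> \<open>This cuts \<open>u\<close> off to the ball translated by \<open>- n a\<close>;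
      periodicity makes its integral independent of \<open>n\<close>, while pointwise it is
      eventually zero.\<close>
    let ?s = "\<lambda>n t. indicator (ball 0 R) (t + real n *\<^sub>R a) * u t"
    have [measurable]: "(\<lambda>t. indicator (ball 0 R) (t + b) :: real) \<in> borel_measurable lebesgue" for b :: 'a
    proof -
      have "(indicator (ball 0 R) :: 'a \<Rightarrow> real) \<in> borel_measurable lebesgue"
        by (intro borel_measurable_indicator) simp
      from borel_measurable_lebesgue_translate[OF this, of "-b"] show ?thesis by simp
    qed
    have const: "(LINT t|lebesgue. ?s n t) = ?I" for n
    proof -
      have "(LINT t|lebesgue. ?s n t) = (LINT t|lebesgue. ?s n (t - real n *\<^sub>R a))"
        by (rule integral_lebesgue_translate[symmetric]) measurable
      also have "\<dots> = ?I"
      proof (rule integral_cong_AE)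
        show "AE t in lebesgue. ?s n (t - real n *\<^sub>R a) = indicator (ball 0 R) t * u t"
          using pern[of n] by eventually_elim simp
      qed (auto intro!: borel_measurable_times borel_measurable_indicator borel_measurable_lebesgue_translate)
      finally show ?thesis .
    qed
    have "(\<lambda>n. LINT t|lebesgue. ?s n t) \<longlonglongrightarrow> (LINT t|(lebesgue :: 'a measure). (0::real))"
    proof (rule integral_dominated_convergence[where w = u])
      show "AE t in lebesgue. (\<lambda>n. ?s n t) \<longlonglongrightarrow> 0"
      proof (rule AE_I2)
        fix t :: 'a
        have "filterlim (\<lambda>n. real n * norm a - norm t) at_top sequentially"
          using \<open>a \<noteq> 0\<close>
          by (intro filterlim_tendsto_add_at_top[OF tendsto_const, of _ _ "- norm t", simplified]
              filterlim_at_top_mult_tendsto_pos[OF tendsto_const] filterlim_real_sequentially) auto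
        then have "eventually (\<lambda>n. real n * norm a - norm t \<ge> R) sequentially"
          by (simp add: filterlim_at_top)
        then have "eventually (\<lambda>n. ?s n t = 0) sequentially"
        proof eventually_elim
          case (elim n)
          have "norm (real n *\<^sub>R a) \<le> norm (t + real n *\<^sub>R a) + norm t"
            using norm_triangle_ineq4[of "t + real n *\<^sub>R a" t] by simp
          with elim show ?case by (simp add: indicator_def)
        qed
        then show "(\<lambda>n. ?s n t) \<longlonglongrightarrow> 0"
          by (rule tendsto_eventually)
      qed
      show "\<And>n. AE t in lebesgue. norm (?s n t) \<le> u t"
        using nonneg by (simp add: indicator_def)
    qed (use u in auto)
    then show "?I = 0"
      by (simp add: const LIMSEQ_const_iff)
  qed
  \<comment> \<open>Balls of natural radius exhaust the space, so only countably many null sets are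
    discarded.\<close>
  have "AE t in lebesgue. indicator (ball 0 (real R)) t * u t = 0" for R
  proof -
    have "integrable lebesgue (\<lambda>t. indicator (ball 0 (real R)) t * u t)"
      using integrable_real_mult_indicator[OF _ u, of "ball 0 (real R)"] by (simp add: mult.commute)
    from integral_nonneg_eq_0_iff_AE[OF this] show ?thesis
      using zero nonneg by simp
  qed
  then have "AE t in lebesgue. \<forall>R::nat. indicator (ball 0 (real R)) t * u t = 0"
    unfolding AE_all_countable by blast
  then show ?thesis
  proof eventually_elim
    case (elim t)
    obtain R :: nat where "norm t < real R" using reals_Archimedean2 by blast
    then show ?case using elim[rule_format, of R] by simp
  qed
qed

section \<open>Linear systems with more unknowns than equations\<close>

text \<open>Gaussian elimination, by induction on the set \<open>F\<close> of equations. It later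
  serves to combine too many elements of a finite-dimensional span to zero.\<close>

lemma homogeneous_system_nontrivial_solution:
  fixes M :: "'k \<Rightarrow> 'h \<Rightarrow> 'a::field"
  assumes "finite F" "finite K" "card F < card K"
  shows "\<exists>x. (\<exists>k\<in>K. x k \<noteq> 0) \<and> (\<forall>h\<in>F. (\<Sum>k\<in>K. x k * M k h) = 0)"
  using assms
proof (induction F arbitrary: K M rule: finite_induct)
  case empty
  then show ?case by (intro exI[of _ "\<lambda>_. 1"]) (auto simp: card_gt_0_iff)
next
  case (insert h F)
  show ?case
  proof (cases "\<forall>k\<in>K. M k h = 0")
    case True
    then show ?thesis
      using insert.IH[of K M] insert.prems insert.hyps by (auto simp: card_insert_if)
  next
    case False
    then obtain p where p: "p \<in> K" "M p h \<noteq> 0" by blast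
    \<comment> \<open>Equation \<open>j\<close> after the pivot unknown \<open>p\<close> has been
      eliminated by means of equation \<open>h\<close>.\<close>
    define N where "N k j = M k j - M k h / M p h * M p j" for k j
    have "card F < card (K - {p})"
      using insert p by (simp add: card_insert_if)
    then obtain x k0 where x: "k0 \<in> K - {p}" "x k0 \<noteq> 0" "\<forall>j\<in>F. (\<Sum>k\<in>K - {p}. x k * N k j) = 0"
      using insert.IH[of "K - {p}" N] insert.prems by blast
    \<comment> \<open>Back substitution: the value at \<open>p\<close> is the one that equation
      \<open>h\<close> dictates.\<close>
    define y where "y = x(p := - (\<Sum>k\<in>K - {p}. x k * M k h) / M p h)"
    have "(\<Sum>k\<in>K. y k * M k j) = (\<Sum>k\<in>K - {p}. x k * N k j)" for j
    proof -
      have "(\<Sum>k\<in>K. y k * M k j) = y p * M p j + (\<Sum>k\<in>K - {p}. x k * M k j)"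
        using p insert.prems by (simp add: sum.remove y_def)
      also have "y p * M p j = - (\<Sum>k\<in>K - {p}. x k * (M k h / M p h * M p j))"
        by (simp add: y_def sum_distrib_left sum_distrib_right sum_divide_distrib algebra_simps)
      finally show ?thesis
        by (simp add: N_def right_diff_distrib sum_subtractf)
    qed
    moreover have "N k h = 0" for k using p by (simp add: N_def)
    ultimately have "\<forall>j\<in>insert h F. (\<Sum>k\<in>K. y k * M k j) = 0"
      using x(3) by simp
    moreover have "y k0 \<noteq> 0" "k0 \<in> K" using x by (auto simp: y_def)
    ultimately show ?thesis by blast
  qed
qed

section \<open>Closure properties of square-integrable functions\<close>

lemma L2_I: "f \<in> borel_measurable lebesgue \<Longrightarrow> integrable lebesgue (\<lambda>t. (cmod (f t))\<^sup>2) \<Longrightarrow> f \<in> L2"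
  by (simp add: L2_def)

lemma L2_D:
  assumes "f \<in> L2"
  shows L2_borel_measurable: "f \<in> borel_measurable lebesgue"
    and L2_integrable_square: "integrable lebesgue (\<lambda>t. (cmod (f t))\<^sup>2)"
  using assms by (simp_all add: L2_def)

lemma L2_cmult:
  assumes "f \<in> L2"
  shows "(\<lambda>t. c * f t) \<in> L2"
  using L2_D[OF assms] by (intro L2_I) (simp_all add: norm_mult power_mult_distrib)

lemma L2_add:
  assumes "f \<in> L2" "h \<in> L2"
  shows "(\<lambda>t. f t + h t) \<in> L2"
proof (rule L2_I)
  note [measurable] = L2_borel_measurable[OF assms(1)] L2_borel_measurable[OF assms(2)]
  show "(\<lambda>t. f t + h t) \<in> borel_measurable lebesgue" by measurable
  have "(cmod (f t + h t))\<^sup>2 \<le> 2 * (cmod (f t))\<^sup>2 + 2 * (cmod (h t))\<^sup>2" for t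
  proof -
    have "(cmod (f t + h t))\<^sup>2 \<le> (cmod (f t) + cmod (h t))\<^sup>2"
      by (intro power_mono norm_triangle_ineq) simp
    moreover have "0 \<le> (cmod (f t) - cmod (h t))\<^sup>2" by simp
    ultimately show ?thesis by (simp add: power2_sum power2_diff)
  qed
  then have "AE t in lebesgue. norm ((cmod (f t + h t))\<^sup>2)
      \<le> norm (2 * (cmod (f t))\<^sup>2 + 2 * (cmod (h t))\<^sup>2)"
    by (intro AE_I2) (simp add: order_trans[OF _ abs_ge_self])
  moreover have "integrable lebesgue (\<lambda>t. 2 * (cmod (f t))\<^sup>2 + 2 * (cmod (h t))\<^sup>2)"
    using assms[THEN L2_integrable_square] by simp
  moreover have "(\<lambda>t. (cmod (f t + h t))\<^sup>2) \<in> borel_measurable lebesgue" by measurable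
  ultimately show "integrable lebesgue (\<lambda>t. (cmod (f t + h t))\<^sup>2)"
    using Bochner_Integration.integrable_bound by blast
qed

lemma L2_translate:
  assumes "f \<in> L2"
  shows "(\<lambda>t. f (t - a)) \<in> L2"
  using L2_D[OF assms]
  by (intro L2_I borel_measurable_lebesgue_translate
      integrable_lebesgue_translate[where f = "\<lambda>t. (cmod (f t))\<^sup>2"])

lemma L2_reflect:
  assumes "f \<in> L2"
  shows "(\<lambda>t. f (- t)) \<in> L2"
  using borel_measurable_lebesgue_reflect[of f 0]
    integrable_lebesgue_reflect[of "\<lambda>t. (cmod (f t))\<^sup>2" 0] L2_D[OF assms]
  by (intro L2_I) simp_all

lemma L2_sum:
  assumes "finite K" "\<And>k. k \<in> K \<Longrightarrow> f k \<in> L2"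
  shows "(\<lambda>t. \<Sum>k\<in>K. f k t) \<in> L2"
  using assms
proof (induction K rule: finite_induct)
  case empty
  then show ?case by (simp add: L2_def)
next
  case (insert k K)
  then show ?case by (simp add: L2_add)
qed

lemma continuous_imp_lebesgue_measurable:
  fixes f :: "'a::euclidean_space \<Rightarrow> 'b::euclidean_space"
  assumes "continuous_on UNIV f"
  shows "f \<in> borel_measurable lebesgue"
  using borel_measurable_continuous_onI[OF assms] by (intro measurable_completion) simp

section \<open>Integrability and linearity of the short-time Fourier transform\<close>

lemma cis_inner_measurable:
  "(\<lambda>t::'a::euclidean_space. cis (c + k * (b \<bullet> t))) \<in> borel_measurable lebesgue"
  by (intro continuous_imp_lebesgue_measurable continuous_intros)

text \<open>With \<open>cis\<close>, the phase identities below reduce to adding angles.\<close>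

lemma STFT_eq_cis:
  "STFT g f z = (LINT t|lebesgue. f t * cnj (g (t - pos_part z)) * cis (- 2 * pi * (freq_part z \<bullet> t)))"
  unfolding STFT_def by (simp add: cis_conv_exp mult_ac)

text \<open>The product is dominated by the sum of the squares. Integrability must be known before
  the integral is split, since a nonintegrable function has integral 0 by convention.\<close>

lemma STFT_integrand_integrable:
  assumes "f \<in> L2" "g \<in> L2"
  shows "integrable lebesgue (\<lambda>t. f t * cnj (g (t - x)) * cis (k * (b \<bullet> t)))"
proof -
  note g = L2_translate[OF assms(2), of x]
  have "cmod (f t * cnj (g (t - x)) * cis (k * (b \<bullet> t)))
      \<le> (cmod (f t))\<^sup>2 + (cmod (g (t - x)))\<^sup>2" for t
  proof -
    have "0 \<le> (cmod (f t) - cmod (g (t - x)))\<^sup>2" by simp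
    moreover have "0 \<le> (cmod (f t))\<^sup>2 + (cmod (g (t - x)))\<^sup>2" by simp
    ultimately have "cmod (f t) * cmod (g (t - x)) \<le> (cmod (f t))\<^sup>2 + (cmod (g (t - x)))\<^sup>2"
      unfolding power2_diff by linarith
    then show ?thesis by (simp add: norm_mult)
  qed
  then have "AE t in lebesgue. norm (f t * cnj (g (t - x)) * cis (k * (b \<bullet> t)))
      \<le> norm ((cmod (f t))\<^sup>2 + (cmod (g (t - x)))\<^sup>2)"
    by (intro AE_I2) (simp only: real_norm_def abs_of_nonneg sum_power2_ge_zero)
  moreover have "integrable lebesgue (\<lambda>t. (cmod (f t))\<^sup>2 + (cmod (g (t - x)))\<^sup>2)"
    using L2_integrable_square[OF assms(1)] L2_integrable_square[OF g] by simp
  moreover have "(\<lambda>t. f t * cnj (g (t - x)) * cis (k * (b \<bullet> t))) \<in> borel_measurable lebesgue"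
    using cis_inner_measurable[of 0 k b]
    by (intro borel_measurable_times L2_borel_measurable[OF assms(1)]
        measurable_compose[OF L2_borel_measurable[OF g], of cnj]
        borel_measurable_continuous_onI continuous_intros) simp
  ultimately show ?thesis
    using Bochner_Integration.integrable_bound by blast
qed

lemma STFT_linear:
  assumes "g \<in> L2" "f \<in> L2" "h \<in> L2"
  shows "STFT g (\<lambda>t. c * f t + d * h t) z = c * STFT g f z + d * STFT g h z"
proof -
  note I = STFT_integrand_integrable[OF _ assms(1), of _ "pos_part z" "- 2 * pi" "freq_part z"]
  have "STFT g (\<lambda>t. c * f t + d * h t) z = (LINT t|lebesgue.
      c * (f t * cnj (g (t - pos_part z)) * cis (- 2 * pi * (freq_part z \<bullet> t)))
      + d * (h t * cnj (g (t - pos_part z)) * cis (- 2 * pi * (freq_part z \<bullet> t))))"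
    unfolding STFT_eq_cis by (simp add: algebra_simps)
  also have "\<dots> = c * STFT g f z + d * STFT g h z"
    unfolding STFT_eq_cis using I[OF assms(2)] I[OF assms(3)] by simp
  finally show ?thesis .
qed

section \<open>Phase space and time-frequency shifts\<close>

lemma pos_part_simps [simp]:
  "pos_part (z - w) = pos_part z - pos_part w" "pos_part (c *\<^sub>R w) = c *\<^sub>R pos_part w"
  "pos_part 0 = 0"
  by (simp_all add: pos_part_def vec_eq_iff)

lemma freq_part_simps [simp]:
  "freq_part (z - w) = freq_part z - freq_part w" "freq_part (c *\<^sub>R w) = c *\<^sub>R freq_part w"
  "freq_part 0 = 0"
  by (simp_all add: freq_part_def vec_eq_iff)

lemma phase_space_eq_0_iff: "z = 0 \<longleftrightarrow> pos_part z = 0 \<and> freq_part z = 0"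
  by (auto simp: pos_part_def freq_part_def vec_eq_iff) (metis sumE)

text \<open>The phase factor is split symmetrically between translation and modulation, which makes
  the shifts along a line a one-parameter group.\<close>
definition tf_shift :: "real^('d::finite + 'd) \<Rightarrow> (real^'d \<Rightarrow> complex) \<Rightarrow> real^'d \<Rightarrow> complex" where
  "tf_shift w f t =
     cis (pi * (2 * (freq_part w \<bullet> t) - pos_part w \<bullet> freq_part w)) * f (t - pos_part w)"

lemma tf_shift_0 [simp]: "tf_shift 0 f = f"
  by (simp add: tf_shift_def fun_eq_iff)

lemma tf_shift_scaleR_Suc:
  "tf_shift (real (Suc k) *\<^sub>R w) f = tf_shift w (tf_shift (real k *\<^sub>R w) f)"
proof
  fix t
  let ?a = "pos_part w" and ?b = "freq_part w"
  \<comment> \<open>The inner shift is evaluated at \<open>t - ?a\<close>, which contributes the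
    cross term \<open>2 k\<close>; the multiples of \<open>?a \<bullet> ?b\<close> then add up to
    \<open>1 + 2 k + k^2\<close>, the square of \<open>Suc k\<close>.\<close>
  have "cis (pi * (2 * (?b \<bullet> t) - ?a \<bullet> ?b)) *
      cis (pi * (2 * (real k *\<^sub>R ?b \<bullet> (t - ?a)) - real k *\<^sub>R ?a \<bullet> real k *\<^sub>R ?b))
    = cis (pi * (2 * (real (Suc k) *\<^sub>R ?b \<bullet> t) - real (Suc k) *\<^sub>R ?a \<bullet> real (Suc k) *\<^sub>R ?b))"
    by (simp add: cis_mult inner_diff_right inner_commute algebra_simps)
  moreover have "t - ?a - real k *\<^sub>R ?a = t - real (Suc k) *\<^sub>R ?a"
    by (simp add: algebra_simps)
  ultimately show "tf_shift (real (Suc k) *\<^sub>R w) f t = tf_shift w (tf_shift (real k *\<^sub>R w) f) t"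
    unfolding tf_shift_def pos_part_simps freq_part_simps by (simp only: mult.assoc[symmetric])
qed

lemma tf_shift_linear_combination:
  "tf_shift w (\<lambda>t. \<Sum>k\<in>K. c k * f k t) t = (\<Sum>k\<in>K. c k * tf_shift w (f k) t)"
  by (simp add: tf_shift_def sum_distrib_left mult.left_commute)

lemma L2_tf_shift:
  assumes "f \<in> L2"
  shows "tf_shift w f \<in> L2"
proof (rule L2_I)
  note f = L2_translate[OF assms, of "pos_part w"]
  note [measurable] = L2_borel_measurable[OF f]
    cis_inner_measurable[of "- pi * (pos_part w \<bullet> freq_part w)" "2 * pi" "freq_part w"]
  have "tf_shift w f = (\<lambda>t. cis (- pi * (pos_part w \<bullet> freq_part w) + 2 * pi * (freq_part w \<bullet> t))
      * f (t - pos_part w))"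
    by (simp add: tf_shift_def fun_eq_iff algebra_simps)
  then show "tf_shift w f \<in> borel_measurable lebesgue" by (simp only:) measurable
  show "integrable lebesgue (\<lambda>t. (cmod (tf_shift w f t))\<^sup>2)"
    using L2_integrable_square[OF f] by (simp add: tf_shift_def norm_mult)
qed

section \<open>Covariance of the transform and its reality up to a phase\<close>

text \<open>Covariance, by the substitution of \<open>t - pos_part w\<close> for \<open>t\<close>.
  The phase left over depends on \<open>z\<close>, which is why reality of the shifted transform
  will need a condition linking \<open>z\<close> and \<open>w\<close>.\<close>

lemma STFT_tf_shift:
  assumes "g \<in> L2" "f \<in> L2"
  shows "STFT g (tf_shift w f) z =
    cis (pi * (pos_part w \<bullet> freq_part w - 2 * (freq_part z \<bullet> pos_part w))) * STFT g f (z - w)"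
proof -
  let ?a = "pos_part w" and ?b = "freq_part w" and ?x = "pos_part z" and ?\<omega> = "freq_part z"
  let ?F = "\<lambda>t. f t * cnj (g (t - (?x - ?a))) * cis (- 2 * pi * ((?\<omega> - ?b) \<bullet> t))"
  let ?c = "cis (pi * (?a \<bullet> ?b - 2 * (?\<omega> \<bullet> ?a)))"
  have "?F \<in> borel_measurable lebesgue"
    by (rule borel_measurable_integrable[OF STFT_integrand_integrable[OF assms(2,1)]])
  then have "(LINT t|lebesgue. ?F (t - ?a)) = (LINT t|lebesgue. ?F t)"
    by (rule integral_lebesgue_translate)
  then have "?c * STFT g f (z - w) = (LINT t|lebesgue. ?c * ?F (t - ?a))"
    by (simp add: STFT_eq_cis)
  also have "\<dots> = STFT g (tf_shift w f) z"
    unfolding STFT_eq_cis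
  proof (rule Bochner_Integration.integral_cong[OF refl])
    fix t
    have phase: "?c * cis (- 2 * pi * ((?\<omega> - ?b) \<bullet> (t - ?a))) =
        cis (pi * (2 * (?b \<bullet> t) - ?a \<bullet> ?b)) * cis (- 2 * pi * (?\<omega> \<bullet> t))"
      by (simp add: cis_mult inner_diff_left inner_diff_right inner_commute algebra_simps)
    have "t - ?a - (?x - ?a) = t - ?x" by simp
    then have "?c * ?F (t - ?a) = (?c * cis (- 2 * pi * ((?\<omega> - ?b) \<bullet> (t - ?a))))
        * (f (t - ?a) * cnj (g (t - ?x)))"
      by (simp only: mult_ac)
    also have "\<dots> = tf_shift w f t * cnj (g (t - ?x)) * cis (- 2 * pi * (?\<omega> \<bullet> t))"
      unfolding phase tf_shift_def by (simp only: mult_ac)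
    finally show "?c * ?F (t - ?a) =
        tf_shift w f t * cnj (g (t - ?x)) * cis (- 2 * pi * (?\<omega> \<bullet> t))" .
  qed
  finally show ?thesis ..
qed

text \<open>Up to the phase, this transform is the Wigner distribution of the window.\<close>
lemma STFT_reflected_window_real:
  assumes "g \<in> L2"
  shows "cis (pi * (pos_part z \<bullet> freq_part z)) * STFT g (\<lambda>t. g (- t)) z \<in> \<real>"
proof -
  let ?x = "pos_part z" and ?\<omega> = "freq_part z"
  let ?F = "\<lambda>t. g (- t) * cnj (g (t - ?x)) * cis (- 2 * pi * (?\<omega> \<bullet> t))"
  have F: "?F \<in> borel_measurable lebesgue"
    by (rule borel_measurable_integrable[OF STFT_integrand_integrable[OF L2_reflect[OF assms] assms]])
  then have "(\<lambda>t. cnj (?F t)) \<in> borel_measurable lebesgue"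
    by (rule measurable_compose) (intro borel_measurable_continuous_onI continuous_intros)
  \<comment> \<open>Reflecting \<open>t\<close> to \<open>?x - t\<close> exchanges the two window
    factors, and conjugation undoes the exchange. The integrand returns with twice the angle of the
    claimed phase, so the phased value equals its own conjugate.\<close>
  from integral_lebesgue_reflect[OF this, of ?x]
  have "cnj (STFT g (\<lambda>t. g (- t)) z) = (LINT t|lebesgue. cnj (?F (?x - t)))"
    unfolding STFT_eq_cis Bochner_Integration.integral_cnj[symmetric] ..
  also have "\<dots> = (LINT t|lebesgue. cis (2 * pi * (?x \<bullet> ?\<omega>)) * ?F t)"
  proof (rule Bochner_Integration.integral_cong[OF refl])
    fix t
    have phase: "cnj (cis (- 2 * pi * (?\<omega> \<bullet> (?x - t)))) =
        cis (2 * pi * (?x \<bullet> ?\<omega>)) * cis (- 2 * pi * (?\<omega> \<bullet> t))"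
      by (simp add: cis_cnj cis_mult inner_diff_right inner_commute algebra_simps)
    have "- (?x - t) = t - ?x" "?x - t - ?x = - t" by simp_all
    then have "cnj (?F (?x - t)) = cnj (g (t - ?x)) * g (- t) * cnj (cis (- 2 * pi * (?\<omega> \<bullet> (?x - t))))"
      by (simp only: complex_cnj_mult complex_cnj_cnj)
    also have "\<dots> = cis (2 * pi * (?x \<bullet> ?\<omega>)) * ?F t"
      unfolding phase by (simp only: mult_ac)
    finally show "cnj (?F (?x - t)) = cis (2 * pi * (?x \<bullet> ?\<omega>)) * ?F t" .
  qed
  also have "\<dots> = cis (2 * pi * (?x \<bullet> ?\<omega>)) * STFT g (\<lambda>t. g (- t)) z"
    unfolding STFT_eq_cis by simp
  finally have "cnj (STFT g (\<lambda>t. g (- t)) z) = cis (2 * pi * (?x \<bullet> ?\<omega>)) * STFT g (\<lambda>t. g (- t)) z" .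
  then show ?thesis
    by (simp add: Reals_cnj_iff cis_cnj cis_mult flip: mult.assoc)
qed

lemma cis_pi_int_real: "n \<in> \<int> \<Longrightarrow> cis (pi * n) \<in> \<real>"
  by (auto elim!: Ints_cases simp: complex_is_Real_iff)

text \<open>Replacing the phase belonging to \<open>z - w\<close> by the one belonging to
  \<open>z\<close> costs \<open>cis (pi * n)\<close>, where \<open>n\<close> is the symplectic
  pairing of \<open>w\<close> and \<open>z\<close>. For an integer \<open>n\<close> this is a
  sign.\<close>

lemma STFT_tf_shift_real:
  assumes "g \<in> L2" "\<phi> \<in> L2"
    and real: "cis (pi * (pos_part (z - w) \<bullet> freq_part (z - w))) * STFT g \<phi> (z - w) \<in> \<real>"
    and int: "freq_part w \<bullet> pos_part z - pos_part w \<bullet> freq_part z \<in> \<int>"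
  shows "cis (pi * (pos_part z \<bullet> freq_part z)) * STFT g (tf_shift w \<phi>) z \<in> \<real>"
proof -
  let ?a = "pos_part w" and ?b = "freq_part w" and ?x = "pos_part z" and ?\<omega> = "freq_part z"
  have "cis (pi * (?x \<bullet> ?\<omega>)) * cis (pi * (?a \<bullet> ?b - 2 * (?\<omega> \<bullet> ?a)))
      = cis (pi * (?b \<bullet> ?x - ?a \<bullet> ?\<omega>)) * cis (pi * (pos_part (z - w) \<bullet> freq_part (z - w)))"
    by (simp add: cis_mult inner_diff_left inner_diff_right inner_commute algebra_simps)
  then have "cis (pi * (?x \<bullet> ?\<omega>)) * STFT g (tf_shift w \<phi>) z
      = cis (pi * (?b \<bullet> ?x - ?a \<bullet> ?\<omega>))
        * (cis (pi * (pos_part (z - w) \<bullet> freq_part (z - w))) * STFT g \<phi> (z - w))"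
    unfolding STFT_tf_shift[OF assms(1,2)] by (simp only: mult.assoc[symmetric])
  with real cis_pi_int_real[OF int] show ?thesis by simp
qed

section \<open>Linear independence of the shifts along a line\<close>

text \<open>If \<open>w\<close> moves positions, the squared modulus of an eigenfunction is
  quasiperiodic and integrable, hence zero. Otherwise the shift is a modulation, and an
  eigenfunction can live only where the modulation equals \<open>e\<close>, a null set.\<close>

lemma tf_shift_no_eigenvector:
  assumes "\<psi> \<in> L2" "w \<noteq> 0" and eig: "AE t in lebesgue. tf_shift w \<psi> t = e * \<psi> t"
  shows "AE t in lebesgue. \<psi> t = 0"
proof (cases "pos_part w = 0")
  case False
  have "AE t in lebesgue. (cmod (\<psi> (t - pos_part w)))\<^sup>2 = (cmod e)\<^sup>2 * (cmod (\<psi> t))\<^sup>2"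
    using eig
  proof eventually_elim
    case (elim t)
    from arg_cong[OF this, of "\<lambda>y. (cmod y)\<^sup>2"] show ?case
      by (simp add: tf_shift_def norm_mult power_mult_distrib)
  qed
  from AE_zero_if_translation_quasiperiodic[OF L2_integrable_square[OF assms(1)] _ False this]
  show ?thesis by simp
next
  case True
  with \<open>w \<noteq> 0\<close> have b: "freq_part w \<noteq> 0" by (simp add: phase_space_eq_0_iff)
  have "AE t in lebesgue. cis (2 * pi * (freq_part w \<bullet> t)) \<noteq> e"
  proof (cases "\<exists>s. cis (2 * pi * (freq_part w \<bullet> s)) = e")
    case True
    then obtain s where s: "cis (2 * pi * (freq_part w \<bullet> s)) = e" ..
    \<comment> \<open>A nonempty level set of the modulation is the union of these parallel
      hyperplanes over all integers \<open>n\<close>.\<close>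
    have "AE t in lebesgue. freq_part w \<bullet> t \<noteq> freq_part w \<bullet> s + real_of_int n" for n
      using negligible_hyperplane[of "freq_part w" "freq_part w \<bullet> s + real_of_int n"] b
      by (intro AE_I'[of "{t. freq_part w \<bullet> t = freq_part w \<bullet> s + real_of_int n}"])
        (auto simp: negligible_iff_null_sets)
    then have "AE t in lebesgue. \<forall>n. freq_part w \<bullet> t \<noteq> freq_part w \<bullet> s + real_of_int n"
      unfolding AE_all_countable by blast
    then show ?thesis
    proof eventually_elim
      case (elim t)
      show ?case
      proof
        assume "cis (2 * pi * (freq_part w \<bullet> t)) = e"
        with s have "cis (2 * pi * (freq_part w \<bullet> t)) = cis (2 * pi * (freq_part w \<bullet> s))" by simp
        then obtain n where "2 * pi * (freq_part w \<bullet> t) = 2 * pi * (freq_part w \<bullet> s) + 2 * pi * real_of_int n"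
          using sin_cos_eq_iff by (auto simp: complex_eq_iff)
        then have "2 * pi * (freq_part w \<bullet> t) = 2 * pi * (freq_part w \<bullet> s + real_of_int n)"
          by (simp only: distrib_left)
        then have "freq_part w \<bullet> t = freq_part w \<bullet> s + real_of_int n" by simp
        with elim show False by blast
      qed
    qed
  qed simp
  with eig show ?thesis
    by eventually_elim (use True in \<open>simp add: tf_shift_def mult_ac\<close>)
qed

text \<open>The sum is \<open>p\<close> evaluated at the operator \<open>tf_shift w\<close>, applied
  to \<open>\<phi>\<close>. Splitting off a root \<open>e\<close> leaves a function
  \<open>\<psi>\<close> that would be an eigenvector, so it vanishes, and the cofactor
  \<open>q\<close> has smaller degree.\<close>

lemma tf_shift_poly_injective:
  assumes "\<phi> \<in> L2" "w \<noteq> 0" "p \<noteq> 0"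
    and "AE t in lebesgue. (\<Sum>k\<le>degree p. coeff p k * tf_shift (real k *\<^sub>R w) \<phi> t) = 0"
  shows "AE t in lebesgue. \<phi> t = 0"
  using assms(3,4)
proof (induction "degree p" arbitrary: p)
  case 0
  then obtain c where "p = [:c:]" "c \<noteq> 0" by (metis degree_eq_zeroE pCons_eq_0_iff)
  with 0 show ?case by simp
next
  case (Suc n)
  then have "\<not> constant (poly p)"
    by (simp add: constant_degree)
  then obtain e where "poly p e = 0" using fundamental_theorem_of_algebra by blast
  then obtain q where q: "p = [:-e, 1:] * q" by (auto simp: poly_eq_0_iff_dvd)
  have "q \<noteq> 0" using Suc.prems q by auto
  then have deg: "degree p = Suc (degree q)" unfolding q by (subst degree_mult_eq) auto
  define \<psi> where "\<psi> t = (\<Sum>k\<le>degree q. coeff q k * tf_shift (real k *\<^sub>R w) \<phi> t)" for t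
  have "(\<Sum>k\<le>degree p. coeff p k * tf_shift (real k *\<^sub>R w) \<phi> t) = tf_shift w \<psi> t - e * \<psi> t" for t
  proof -
    \<comment> \<open>Multiplication by the variable moves each coefficient up by one index, which
      corresponds to one more application of \<open>tf_shift w\<close>.\<close>
    have "coeff p k = coeff (pCons 0 q) k - e * coeff q k" for k
      by (simp add: q)
    then have "(\<Sum>k\<le>degree p. coeff p k * tf_shift (real k *\<^sub>R w) \<phi> t)
        = (\<Sum>k\<le>Suc (degree q). coeff (pCons 0 q) k * tf_shift (real k *\<^sub>R w) \<phi> t)
          - e * (\<Sum>k\<le>Suc (degree q). coeff q k * tf_shift (real k *\<^sub>R w) \<phi> t)"
      by (simp only: deg left_diff_distrib sum_subtractf sum_distrib_left mult.assoc)
    also have "(\<Sum>k\<le>Suc (degree q). coeff (pCons 0 q) k * tf_shift (real k *\<^sub>R w) \<phi> t)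
        = (\<Sum>k\<le>degree q. coeff q k * tf_shift w (tf_shift (real k *\<^sub>R w) \<phi>) t)"
      by (simp only: sum.atMost_Suc_shift tf_shift_scaleR_Suc) simp
    also have "\<dots> = tf_shift w \<psi> t"
      unfolding \<psi>_def tf_shift_linear_combination ..
    also have "(\<Sum>k\<le>Suc (degree q). coeff q k * tf_shift (real k *\<^sub>R w) \<phi> t) = \<psi> t"
      by (simp add: \<psi>_def coeff_eq_0)
    finally show ?thesis .
  qed
  with Suc.prems have "AE t in lebesgue. tf_shift w \<psi> t = e * \<psi> t" by simp
  moreover have "\<psi> \<in> L2"
    unfolding \<psi>_def by (intro L2_sum L2_cmult L2_tf_shift assms) simp
  ultimately have "AE t in lebesgue. \<psi> t = 0"
    using tf_shift_no_eigenvector[OF _ \<open>w \<noteq> 0\<close>] by blast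
  then show ?case
    using Suc.hyps(1)[of q] Suc.hyps(2) deg \<open>q \<noteq> 0\<close> by (simp add: \<psi>_def)
qed

lemma tf_shifts_independent:
  assumes "\<phi> \<in> L2" "\<not> (AE t in lebesgue. \<phi> t = 0)" "w \<noteq> 0" "finite K"
    and zero: "AE t in lebesgue. (\<Sum>k\<in>K. c k * tf_shift (real k *\<^sub>R w) \<phi> t) = 0"
    and "j \<in> K"
  shows "c j = 0"
proof -
  define p where "p = (\<Sum>k\<in>K. monom (c k) k)"
  have coeff: "coeff p k = (if k \<in> K then c k else 0)" for k
    using \<open>finite K\<close> by (simp add: p_def coeff_sum)
  have "(\<Sum>k\<le>degree p. coeff p k * u k) = (\<Sum>k\<in>K. c k * u k)" for u :: "nat \<Rightarrow> complex"
  proof -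
    \<comment> \<open>\<open>K\<close> may have gaps and may exceed the degree of \<open>p\<close>
      where \<open>c\<close> vanishes, so both sums are compared over the union.\<close>
    have "(\<Sum>k\<le>degree p. coeff p k * u k) = (\<Sum>k\<in>{..degree p} \<union> K. coeff p k * u k)"
      by (rule sum.mono_neutral_left) (use \<open>finite K\<close> in \<open>auto intro: coeff_eq_0\<close>)
    also have "\<dots> = (\<Sum>k\<in>K. coeff p k * u k)"
      by (rule sum.mono_neutral_right) (use \<open>finite K\<close> in \<open>auto simp: coeff\<close>)
    finally show ?thesis by (simp add: coeff)
  qed
  then have "p = 0"
    using tf_shift_poly_injective[OF assms(1,3), of p] assms(2) zero by auto
  then show ?thesis using coeff[of j] \<open>j \<in> K\<close> by simp
qed

section \<open>Dual lattice and symplectic form\<close>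

lemma lattice_dual_vector:
  assumes "is_lattice \<Lambda>"
  obtains \<mu> :: "real^'d::finite" where "\<mu> \<noteq> 0" "\<And>v. v \<in> \<Lambda> \<Longrightarrow> \<mu> \<bullet> v \<in> \<int>"
proof -
  obtain A :: "real^'d^'d" where A: "invertible A"
    and \<Lambda>: "\<Lambda> = {A *v (\<chi> i. real_of_int (k $ i)) | k :: int^'d. True}"
    using assms by (auto simp: is_lattice_def)
  obtain B where B: "B ** A = mat 1" using A by (auto simp: invertible_def)
  obtain i :: 'd where True by simp
  \<comment> \<open>Row \<open>i\<close> of the inverse of \<open>A\<close>, so that pairing with a
    lattice point reads off its integer coordinate \<open>i\<close>.\<close>
  define \<mu> where "\<mu> = transpose B *v axis i 1"
  have \<mu>: "\<mu> \<bullet> (A *v v) = v $ i" for v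
  proof -
    have "\<mu> \<bullet> (A *v v) = axis i 1 \<bullet> (B *v (A *v v))"
      unfolding \<mu>_def transpose_matrix_vector dot_lmul_matrix ..
    then show ?thesis
      by (simp add: matrix_vector_mul_assoc B inner_axis')
  qed
  show thesis
  proof
    show "\<mu> \<noteq> 0" using \<mu>[of "axis i 1"] by auto
    show "\<mu> \<bullet> v \<in> \<int>" if "v \<in> \<Lambda>" for v using that \<Lambda> \<mu> by auto
  qed
qed

text \<open>Identifies the pairing required to be an integer in \<open>STFT_tf_shift_real\<close>,
  up to sign, with the form that symplectic matrices preserve.\<close>

lemma symplectic_form_eq:
  "z \<bullet> (J_mat *v w) = pos_part w \<bullet> freq_part z - freq_part w \<bullet> pos_part z"
proof -
  have split: "(\<Sum>j\<in>UNIV. u j) = (\<Sum>i\<in>UNIV. u (Inl i)) + (\<Sum>i\<in>UNIV. u (Inr i))"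
    for u :: "'a + 'a \<Rightarrow> real"
    using sum.Plus[of "UNIV :: 'a set" "UNIV :: 'a set" u] by (simp add: comp_def)
  have Inl: "(J_mat *v w) $ Inl i = - (w $ Inr i)" for i
    by (simp add: matrix_vector_mult_def J_mat_def split if_distrib[of "\<lambda>a. a * b" for b] cong: if_cong)
  have Inr: "(J_mat *v w) $ Inr i = w $ Inl i" for i
    by (simp add: matrix_vector_mult_def J_mat_def split if_distrib[of "\<lambda>a. a * b" for b] cong: if_cong)
  have "z \<bullet> (J_mat *v w) = (\<Sum>i\<in>UNIV. z $ Inl i * - (w $ Inr i)) + (\<Sum>i\<in>UNIV. z $ Inr i * w $ Inl i)"
    unfolding inner_vec_def split Inl Inr by simp
  also have "\<dots> = pos_part w \<bullet> freq_part z - freq_part w \<bullet> pos_part z"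
    by (simp add: inner_vec_def pos_part_def freq_part_def sum_negf mult.commute)
  finally show ?thesis .
qed

lemma symplectic_form_preserved:
  assumes "symplectic S"
  shows "(S *v z) \<bullet> (J_mat *v (S *v w)) = z \<bullet> (J_mat *v w)"
proof -
  have "(S *v z) \<bullet> (J_mat *v (S *v w)) = z \<bullet> ((transpose S ** J_mat ** S) *v w)"
    by (subst (1 2) inner_commute)
      (simp add: transpose_matrix_vector dot_lmul_matrix flip: matrix_vector_mul_assoc)
  with assms show ?thesis by (simp add: symplectic_def)
qed

lemma integral_symplectic_direction:
  fixes S :: "real^('d::finite + 'd)^('d + 'd)"
  assumes S: "symplectic S" and \<Lambda>: "is_lattice \<Lambda>"
    and L: "L \<subseteq> {S *v z | z. freq_part z \<in> \<Lambda>}"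
  obtains w :: "real^('d + 'd)" where "w \<noteq> 0"
    "\<And>z. z \<in> L \<Longrightarrow> freq_part w \<bullet> pos_part z - pos_part w \<bullet> freq_part z \<in> \<int>"
proof -
  obtain \<mu> :: "real^'d" where \<mu>: "\<mu> \<noteq> 0" "\<And>v. v \<in> \<Lambda> \<Longrightarrow> \<mu> \<bullet> v \<in> \<int>"
    using lattice_dual_vector[OF \<Lambda>] by blast
  \<comment> \<open>A pure position vector pairs only with frequency parts, and these lie in the
    lattice before \<open>S\<close> is applied.\<close>
  define m :: "real^('d + 'd)" where "m = (\<chi> j. case j of Inl i \<Rightarrow> \<mu> $ i | Inr i \<Rightarrow> 0)"
  have m: "pos_part m = \<mu>" "freq_part m = 0"
    by (simp_all add: m_def pos_part_def freq_part_def vec_eq_iff)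
  show thesis
  proof
    obtain B where "B ** S = mat 1" using S by (auto simp: symplectic_def invertible_def)
    then have "B *v (S *v m) = m" by (simp add: matrix_vector_mul_assoc)
    moreover have "m \<noteq> 0" using m \<mu>(1) by auto
    ultimately show "S *v m \<noteq> 0" by auto
    fix z assume "z \<in> L"
    then obtain y where y: "z = S *v y" "freq_part y \<in> \<Lambda>" using L by blast
    have "z \<bullet> (J_mat *v (S *v m)) = y \<bullet> (J_mat *v m)"
      by (simp add: y symplectic_form_preserved[OF S])
    then have "freq_part (S *v m) \<bullet> pos_part z - pos_part (S *v m) \<bullet> freq_part z
        = - (\<mu> \<bullet> freq_part y)"
      by (simp add: symplectic_form_eq m)
    then show "freq_part (S *v m) \<bullet> pos_part z - pos_part (S *v m) \<bullet> freq_part z \<in> \<int>"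
      using \<mu>(2)[OF y(2)] by simp
  qed
qed

section \<open>The generator and the cone\<close>

lemma exists_generator_real_STFT:
  fixes g :: "real^'d::finite \<Rightarrow> complex"
  assumes "g \<in> L2"
  obtains \<phi> where "\<phi> \<in> L2" "\<not> (AE t in lebesgue. \<phi> t = 0)"
    "\<And>z. cis (pi * (pos_part z \<bullet> freq_part z)) * STFT g \<phi> z \<in> \<real>"
proof (cases "AE t in lebesgue. g t = 0")
  case True
  \<comment> \<open>The reflected window would vanish here too; since every transform is zero, a
    nonzero function can be chosen freely.\<close>
  let ?\<phi> = "indicator (ball 0 1) :: real^'d \<Rightarrow> complex"
  show thesis
  proof
    have "integrable lebesgue (indicator (ball 0 1) :: real^'d \<Rightarrow> real)"
      using lmeasurable_ball[of "0::real^'d" 1]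
      by (subst integrable_indicator_iff) (simp add: fmeasurable_def)
    moreover have "(cmod (?\<phi> t))\<^sup>2 = indicator (ball 0 1) t" for t
      by (simp add: indicator_def)
    ultimately show "?\<phi> \<in> L2"
      by (intro L2_I borel_measurable_indicator) simp_all
    show "\<not> (AE t in lebesgue. ?\<phi> t = 0)"
    proof
      assume "AE t in lebesgue. ?\<phi> t = 0"
      then have "AE t in lebesgue. t \<notin> ball (0::real^'d) 1"
        by eventually_elim (auto simp: indicator_def split: if_splits)
      then have "ball (0::real^'d) 1 \<in> null_sets lebesgue"
        by (subst AE_iff_null_sets) simp_all
      then show False
        using open_not_negligible[of "ball (0::real^'d) 1"] by (simp add: negligible_iff_null_sets)
    qed
    show "cis (pi * (pos_part z \<bullet> freq_part z)) * STFT g ?\<phi> z \<in> \<real>" for z :: "real^('d + 'd)"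
    proof -
      have "AE t in lebesgue. g (t - pos_part z) = 0"
        using AE_lebesgue_translate[OF True] .
      then have "AE t in lebesgue. ?\<phi> t * cnj (g (t - pos_part z)) * cis (- 2 * pi * (freq_part z \<bullet> t)) = 0"
        by eventually_elim simp
      then have "STFT g ?\<phi> z = 0"
        unfolding STFT_eq_cis by (rule integral_eq_zero_AE)
      then show ?thesis by simp
    qed
  qed
next
  case False
  show thesis
  proof
    show "(\<lambda>t. g (- t)) \<in> L2" by (rule L2_reflect[OF assms])
    show "\<not> (AE t in lebesgue. g (- t) = 0)"
      using False AE_lebesgue_reflect[of "\<lambda>t. g (- t) = 0" 0] by auto
    show "cis (pi * (pos_part z \<bullet> freq_part z)) * STFT g (\<lambda>t. g (- t)) z \<in> \<real>" for z
      by (rule STFT_reflected_window_real[OF assms])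
  qed
qed

theorem theorem1p3:
  fixes g :: "real^'d \<Rightarrow> complex"
    and L :: "(real^('d + 'd)) set"
    and S :: "real^('d + 'd)^('d + 'd)"
    and \<Lambda> :: "(real^'d) set"
  assumes "g \<in> L2"
    and "symplectic S"
    and "is_lattice \<Lambda>"
    and "L \<subseteq> {S *v z | z. freq_part z \<in> \<Lambda>}"
  shows "\<exists>C. C \<subseteq> N_set g L \<and> is_cone C \<and> infinite_dim C"
proof -
  obtain w :: "real^('d + 'd)" where w: "w \<noteq> 0"
    "\<And>z. z \<in> L \<Longrightarrow> freq_part w \<bullet> pos_part z - pos_part w \<bullet> freq_part z \<in> \<int>"
    using integral_symplectic_direction[OF assms(2-4)] by blast
  obtain \<phi> where \<phi>: "\<phi> \<in> L2" "\<not> (AE t in lebesgue. \<phi> t = 0)"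
    and real: "\<And>z. cis (pi * (pos_part z \<bullet> freq_part z)) * STFT g \<phi> z \<in> \<real>"
    using exists_generator_real_STFT[OF assms(1)] by blast
  define U where "U k = tf_shift (real k *\<^sub>R w) \<phi>" for k
  have U0: "U 0 = \<phi>" by (simp add: U_def)
  have U: "U k \<in> L2" for k by (simp add: U_def L2_tf_shift \<phi>)
  have indep: "c j = 0"
    if "finite K" "AE t in lebesgue. (\<Sum>k\<in>K. c k * U k t) = 0" "j \<in> K" for c j and K :: "nat set"
    using tf_shifts_independent[OF \<phi> w(1) that(1) _ that(3), of c] that(2) by (simp add: U_def)
  have U_real: "cis (pi * (pos_part z \<bullet> freq_part z)) * STFT g (U k) z \<in> \<real>" if "z \<in> L" for z k
    unfolding U_def
  proof (rule STFT_tf_shift_real[OF assms(1) \<phi>(1) real])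
    have "real k * (freq_part w \<bullet> pos_part z - pos_part w \<bullet> freq_part z) \<in> \<int>"
      using w(2)[OF that] by (intro Ints_mult) auto
    then show "freq_part (real k *\<^sub>R w) \<bullet> pos_part z - pos_part (real k *\<^sub>R w) \<bullet> freq_part z \<in> \<int>"
      by (simp add: algebra_simps)
  qed
  define f where "f \<kappa> k = (\<lambda>t. of_real \<kappa> * \<phi> t + (of_real \<kappa> * \<i>) * U k t)" for \<kappa> :: real and k
  have f_L2: "f \<kappa> k \<in> L2" for \<kappa> k
    unfolding f_def by (intro L2_add L2_cmult \<phi> U)
  \<comment> \<open>The index 0 is excluded: \<open>U 0\<close> is \<open>\<phi>\<close>, and
    \<open>\<phi> + \<i> \<phi>\<close> and \<open>\<phi> - \<i> \<phi>\<close> differ only by a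
    unimodular factor.\<close>
  define C where "C = {f \<kappa> k | \<kappa> k. \<kappa> > 0 \<and> k \<ge> 1}"
  have "C \<subseteq> N_set g L"
  proof
    fix u assume "u \<in> C"
    then obtain \<kappa> k where u: "u = f \<kappa> k" and \<kappa>: "\<kappa> > 0" and k: "k \<ge> 1" by (auto simp: C_def)
    define h where "h = (\<lambda>t. of_real \<kappa> * \<phi> t + (- (of_real \<kappa> * \<i>)) * U k t)"
    have "h \<in> L2" unfolding h_def by (intro L2_add L2_cmult \<phi> U)
    moreover have "\<not> l2_equiv h u"
    proof
      assume "l2_equiv h u"
      then obtain \<nu> where "AE t in lebesgue. h t = \<nu> * u t" by (auto simp: l2_equiv_def)
      \<comment> \<open>The equation collected by \<open>U 0\<close> and \<open>U k\<close>;
        independence would force both \<open>\<nu> = 1\<close> and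
        \<open>\<nu> = -1\<close>.\<close>
      then have "AE t in lebesgue. (\<Sum>j\<in>{0, k}. (if j = 0 then of_real \<kappa> * (1 - \<nu>)
          else - (of_real \<kappa> * \<i> * (1 + \<nu>))) * U j t) = 0"
      proof eventually_elim
        case (elim t)
        then show ?case using k by (simp add: u f_def h_def U0 algebra_simps)
      qed
      from indep[OF _ this, of 0] indep[OF _ this, of k] \<kappa> k have "\<nu> = 1" "1 + \<nu> = 0" by auto
      then show False by simp
    qed
    moreover have "cmod (STFT g u z) = cmod (STFT g h z)" if z: "z \<in> L" for z
    proof -
      let ?c = "cis (pi * (pos_part z \<bullet> freq_part z))"
      obtain r s where r: "?c * STFT g \<phi> z = of_real r" and s: "?c * STFT g (U k) z = of_real s"
        using real[of z] U_real[OF z, of k] by (auto elim!: Reals_cases)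
      have lin: "cmod (STFT g (\<lambda>t. of_real \<kappa> * \<phi> t + d * U k t) z) = cmod (of_real \<kappa> * of_real r + d * of_real s)" for d
      proof -
        have "cmod (STFT g (\<lambda>t. of_real \<kappa> * \<phi> t + d * U k t) z)
            = cmod (?c * STFT g (\<lambda>t. of_real \<kappa> * \<phi> t + d * U k t) z)"
          by (simp add: norm_mult)
        also have "?c * STFT g (\<lambda>t. of_real \<kappa> * \<phi> t + d * U k t) z
            = of_real \<kappa> * (?c * STFT g \<phi> z) + d * (?c * STFT g (U k) z)"
          unfolding STFT_linear[OF assms(1) \<phi>(1) U] by (simp add: algebra_simps)
        finally show ?thesis by (simp only: r s)
      qed
      \<comment> \<open>As \<open>r\<close> and \<open>s\<close> are real, changing the sign of
        \<open>\<i>\<close> is complex conjugation.\<close>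
      have "of_real \<kappa> * of_real r + - (of_real \<kappa> * \<i>) * of_real s
          = cnj (of_real \<kappa> * of_real r + (of_real \<kappa> * \<i>) * of_real s)"
        by simp
      then show ?thesis
        unfolding u f_def h_def lin by (simp only: complex_mod_cnj)
    qed
    ultimately show "u \<in> N_set g L"
      using f_L2 u unfolding N_set_def by blast
  qed
  moreover have "is_cone C"
    unfolding is_cone_def
  proof (intro allI impI ballI)
    fix \<kappa> :: real and u assume "\<kappa> > 0" "u \<in> C"
    then obtain \<kappa>' k where u: "u = f \<kappa>' k" "\<kappa>' > 0" "k \<ge> 1" by (auto simp: C_def)
    have "(\<lambda>t. of_real \<kappa> * u t) = f (\<kappa> * \<kappa>') k"
      by (simp add: u f_def algebra_simps)
    then show "(\<lambda>t. of_real \<kappa> * u t) \<in> C"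
      using \<open>\<kappa> > 0\<close> u unfolding C_def by (auto intro!: exI[of _ "\<kappa> * \<kappa>'"] exI[of _ k])
  qed
  moreover have "infinite_dim C"
    unfolding infinite_dim_def
  proof (intro allI impI notI)
    fix F :: "(real^'d \<Rightarrow> complex) set"
    assume F: "finite F \<and> F \<subseteq> L2" and "C \<subseteq> l2_span F"
    \<comment> \<open>One index more than \<open>F\<close> has elements, starting at 1 to stay
      inside \<open>C\<close>.\<close>
    define K where "K = {1..Suc (card F)}"
    have "\<exists>c. AE t in lebesgue. f 1 k t = (\<Sum>h\<in>F. c h * h t)" if "k \<in> K" for k
    proof -
      have "f 1 k \<in> C" using that unfolding C_def K_def by (intro CollectI exI[of _ 1] exI[of _ k]) simp
      with \<open>C \<subseteq> l2_span F\<close> show ?thesis by (auto simp: l2_span_def)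
    qed
    then obtain M where M: "\<forall>k\<in>K. AE t in lebesgue. f 1 k t = (\<Sum>h\<in>F. M k h * h t)"
      using bchoice[of K "\<lambda>k c. AE t in lebesgue. f 1 k t = (\<Sum>h\<in>F. c h * h t)"] by blast
    obtain x k0 where x: "k0 \<in> K" "x k0 \<noteq> 0" "\<forall>h\<in>F. (\<Sum>k\<in>K. x k * M k h) = 0"
      using homogeneous_system_nontrivial_solution[of F K M] F unfolding K_def by auto
    have "AE t in lebesgue. \<forall>k\<in>K. f 1 k t = (\<Sum>h\<in>F. M k h * h t)"
      using M by (intro AE_finite_allI) (simp_all add: K_def)
    \<comment> \<open>Every \<open>f 1 k\<close> contains \<open>\<phi>\<close>, so index 0 collects
      the sum of all \<open>x k\<close>. The coefficient at \<open>k0\<close> is still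
      \<open>\<i> * x k0\<close>, which is nonzero.\<close>
    then have "AE t in lebesgue. (\<Sum>k\<in>insert 0 K. (if k = 0 then \<Sum>k\<in>K. x k else \<i> * x k) * U k t) = 0"
    proof eventually_elim
      case (elim t)
      have "(\<Sum>k\<in>insert 0 K. (if k = 0 then \<Sum>k\<in>K. x k else \<i> * x k) * U k t)
          = (\<Sum>k\<in>K. x k) * \<phi> t + (\<Sum>k\<in>K. \<i> * x k * U k t)"
      proof -
        have "(\<Sum>k\<in>K. (if k = 0 then \<Sum>k\<in>K. x k else \<i> * x k) * U k t) = (\<Sum>k\<in>K. \<i> * x k * U k t)"
          by (rule sum.cong) (auto simp: K_def)
        then show ?thesis by (subst sum.insert) (auto simp: K_def U0)
      qed
      also have "\<dots> = (\<Sum>k\<in>K. x k * f 1 k t)"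
        by (simp add: f_def sum_distrib_left sum.distrib algebra_simps)
      also have "\<dots> = (\<Sum>k\<in>K. \<Sum>h\<in>F. x k * M k h * h t)"
        using elim by (simp add: sum_distrib_left mult.assoc)
      also have "\<dots> = (\<Sum>h\<in>F. (\<Sum>k\<in>K. x k * M k h) * h t)"
        by (subst sum.swap) (simp add: sum_distrib_right)
      also have "\<dots> = 0" using x(3) by simp
      finally show ?case .
    qed
    from indep[OF _ this, of k0] x(1,2) show False
      by (auto simp: K_def split: if_splits)
  qed
  ultimately show ?thesis by blast
qed

end
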